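(* For $\epsilon>0$ and $\mathbf{x}\in\mathbb{R}^2$ define $$\boldsymbol{\eta}^\epsilon_1(\mathbf{x})=\frac{\mathbf{x}}{1+\epsilon|\mathbf{x}|},\qquad \boldsymbol{\eta}^\epsilon_2(\mathbf{x})=\frac{\mathbf{x}}{1+\epsilon^2|\mathbf{x}|^2},\qquad \boldsymbol{\eta}^\epsilon_3(\mathbf{x})=\frac1\epsilon\arctan(\epsilon\mathbf{x}),$$ where the arctangent acts componentwise. Then for each $i\in\{1,2,3\}$: (i) $\boldsymbol{\eta}^\epsilon_i$ is Lipschitz continuous with Lipschitz constant $1$; (ii) for $\epsilon>0$ fixed, $\boldsymbol{\eta}^\epsilon_i$ is bounded; (iii) there exist $C>0$, $\alpha>0$, $\beta>0$ (independent of $\epsilon$) such that $|\boldsymbol{\eta}^\epsilon_i(\mathbf{x})-\mathbf{x}|\le C\epsilon^\alpha|\mathbf{x}|^\beta$ for all $\mathbf{x}\in\mathbb{R}^2$. In particular, the following explicit bounds hold for all $\epsilon>0$ and $\mathbf{x}\in\mathbb{R}^2$: $$\|\boldsymbol{\eta}^\epsilon_1\|_{L^\infty}=\frac1\epsilon,\qquad |\boldsymbol{\eta}^\epsilon_1(\mathbf{x})-\mathbf{x}|\le\epsilon|\mathbf{x}|^2;$$ $$\|\boldsymbol{\eta}^\epsilon_2\|_{L^\infty}=\frac1{2\epsilon},\qquad |\boldsymbol{\eta}^\epsilon_2(\mathbf{x})-\mathbf{x}|\le\epsilon^2|\mathbf{x}|^3;$$ $$\|\boldsymbol{\eta}^\epsilon_3\|_{L^\infty}=\frac{\pi}{2\epsilon},\qquad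 |\boldsymbol{\eta}^\epsilon_3(\mathbf{x})-\mathbf{x}|\le\epsilon^2|\mathbf{x}|^3.$$
   Context: $|\cdot|$ is the Euclidean norm on $\mathbb{R}^2$, and Lipschitz continuity is with respect to it. For $\boldsymbol{\eta}=(\eta_1,\eta_2):\mathbb{R}^2\to\mathbb{R}^2$, $\|\boldsymbol{\eta}\|_{L^\infty}=\max_{j=1,2}\sup_{\mathbf{x}\in\mathbb{R}^2}|\eta_j(\mathbf{x})|$. *)

theory Defs
  imports "HOL-Analysis.Analysis"
begin

definition eta1 :: "real \<Rightarrow> real^2 \<Rightarrow> real^2" where
  "eta1 \<epsilon> x = x /\<^sub>R (1 + \<epsilon> * norm x)"

definition eta2 :: "real \<Rightarrow> real^2 \<Rightarrow> real^2" where
  "eta2 \<epsilon> x = x /\<^sub>R (1 + \<epsilon>\<^sup>2 * (norm x)\<^sup>2)"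

definition eta3 :: "real \<Rightarrow> real^2 \<Rightarrow> real^2" where
  "eta3 \<epsilon> x = (1 / \<epsilon>) *\<^sub>R (\<chi> j. arctan ((\<epsilon> *\<^sub>R x) $ j))"

text \<open>The supremum is taken in the extended reals, so that an unbounded function has norm
  \<open>\<infinity>\<close> instead of the unspecified value of a supremum of an unbounded set of reals.\<close>

definition Linf_norm :: "(real^2 \<Rightarrow> real^2) \<Rightarrow> ereal" where
  "Linf_norm \<eta> = (MAX j\<in>{1, 2}. SUP x. ereal \<bar>\<eta> x $ j\<bar>)"

end

theory Submission
  imports Defs
begin

text \<open>For the radial maps, \<open>|s x - t y|\<^sup>2 = (s |x| - t |y|)\<^sup>2 + 2 s t (|x| |y| - x \<bullet> y)\<close> reduces
  the Lipschitz bound to one for the scalar profiles \<open>r / (1 + \<epsilon> r)\<close> and \<open>r / (1 + \<epsilon>\<^sup>2 r\<^sup>2)\<close>. The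
  arctangent is handled componentwise by the mean value theorem. The suprema are found along the first
  coordinate axis.\<close>

section \<open>Radial rescalings of a vector\<close>

text \<open>The angular term \<open>norm x * norm y - x \<bullet> y\<close> is nonnegative by
  Cauchy-Schwarz, so a factor \<open>s * t\<close> in [0, 1] can only shrink it; the third
  hypothesis controls the radial term.\<close>

lemma norm_diff_scaleR_le:
  fixes x y :: "'a::real_inner"
  assumes "0 \<le> s * t" "s * t \<le> 1" "\<bar>s * norm x - t * norm y\<bar> \<le> \<bar>norm x - norm y\<bar>"
  shows "norm (s *\<^sub>R x - t *\<^sub>R y) \<le> norm (x - y)"
proof -
  have eq: "(norm (a *\<^sub>R x - b *\<^sub>R y))\<^sup>2
      = (a * norm x - b * norm y)\<^sup>2 + 2 * (a * b) * (norm x * norm y - x \<bullet> y)" for a b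
    unfolding power2_diff power_mult_distrib power2_norm_eq_inner
    by (simp add: inner_diff_left inner_diff_right inner_commute power2_eq_square algebra_simps)
  have "x \<bullet> y \<le> norm x * norm y"
    by (rule norm_cauchy_schwarz)
  then have "s * t * (norm x * norm y - x \<bullet> y) \<le> 1 * (norm x * norm y - x \<bullet> y)"
    using assms by (intro mult_right_mono) auto
  moreover have "(s * norm x - t * norm y)\<^sup>2 \<le> (norm x - norm y)\<^sup>2"
    using assms(3) by (simp add: abs_le_square_iff)
  ultimately have "(norm (s *\<^sub>R x - t *\<^sub>R y))\<^sup>2 \<le> (norm (x - y))\<^sup>2"
    \<comment> \<open>The instance at \<open>1\<close> and \<open>1\<close> splits
      \<open>norm (x - y)\<close> in the same way, so the two sides compare term by term.\<close>
    using eq[of s t] eq[of 1 1] by simp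
  then show ?thesis
    by (rule power2_le_imp_le) simp
qed

text \<open>Clearing the denominators turns the radial hypothesis into a polynomial inequality,
  which is easy to check for \<open>eta1\<close> and \<open>eta2\<close>.\<close>

lemma norm_diff_divideR_le:
  fixes x y :: "'a::real_inner"
  assumes "1 \<le> p" "1 \<le> q" "\<bar>norm x * q - norm y * p\<bar> \<le> \<bar>norm x - norm y\<bar> * (p * q)"
  shows "norm (x /\<^sub>R p - y /\<^sub>R q) \<le> norm (x - y)"
proof (rule norm_diff_scaleR_le)
  have "1 * 1 \<le> p * q"
    using assms by (intro mult_mono) auto
  then show "inverse p * inverse q \<le> 1" "0 \<le> inverse p * inverse q"
    using assms by (auto simp: divide_simps)
  have "inverse p * norm x - inverse q * norm y = (norm x * q - norm y * p) / (p * q)"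
    using assms by (simp add: field_simps)
  then have "\<bar>inverse p * norm x - inverse q * norm y\<bar> = \<bar>norm x * q - norm y * p\<bar> / (p * q)"
    using assms by (simp add: abs_divide abs_mult)
  also have "\<dots> \<le> \<bar>norm x - norm y\<bar>"
    using assms by (simp add: divide_simps)
  finally show "\<bar>inverse p * norm x - inverse q * norm y\<bar> \<le> \<bar>norm x - norm y\<bar>" .
qed

text \<open>The relative error is exactly a / (1 + a). Taking a = \<epsilon> |x| and a = (\<epsilon>
  |x|)^2 gives the rates of \<open>eta1\<close> and \<open>eta2\<close>.\<close>

lemma norm_divideR_one_plus_diff_le:
  fixes x :: "'a::real_normed_vector"
  assumes "0 \<le> a"
  shows "norm (x /\<^sub>R (1 + a) - x) \<le> a * norm x"
proof -
  have "x /\<^sub>R (1 + a) - x = (inverse (1 + a) - 1) *\<^sub>R x"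
    by (simp add: scaleR_diff_left)
  also have "inverse (1 + a) - 1 = - (a / (1 + a))"
    using assms by (simp add: field_simps)
  finally have "norm (x /\<^sub>R (1 + a) - x) = a / (1 + a) * norm x"
    using assms by simp
  also have "a / (1 + a) \<le> a"
    using assms by (simp add: divide_simps algebra_simps)
  finally show ?thesis
    by (simp add: mult_right_mono)
qed

section \<open>Estimates for the arctangent\<close>

text \<open>This is the mean value theorem between 0 and t with the derivative multiplied out.
  Oddness of \<open>arctan\<close> reduces negative t to positive t.\<close>

lemma arctan_mean_value:
  obtains z where "\<bar>z\<bar> \<le> \<bar>t\<bar>" "arctan t * (1 + z\<^sup>2) = t"
proof -
  have pos: "\<exists>z. \<bar>z\<bar> \<le> \<bar>t\<bar> \<and> arctan t * (1 + z\<^sup>2) = t" if t: "0 < t" for t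
  proof -
    obtain z where z: "0 < z" "z < t" "arctan t - arctan 0 = (t - 0) * inverse (1 + z\<^sup>2)"
      using MVT2[OF t, of arctan "\<lambda>z. inverse (1 + z\<^sup>2)"] DERIV_arctan by blast
    moreover have "1 + z\<^sup>2 \<noteq> 0"
      by (simp add: add_pos_nonneg less_imp_neq[symmetric])
    ultimately show ?thesis
      by (intro exI[of _ z]) (auto simp: field_simps)
  qed
  have "\<exists>z. \<bar>z\<bar> \<le> \<bar>t\<bar> \<and> arctan t * (1 + z\<^sup>2) = t"
    using pos[of t] pos[of "- t"] by (cases t "0 :: real" rule: linorder_cases) (auto simp: arctan_minus)
  then show ?thesis
    using that by blast
qed

text \<open>The intermediate point z gives the error exactly, as -(arctan t) z^2, and both |arctan
  t| and |z| are at most |t|.\<close>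

lemma abs_arctan_diff_self_le: "\<bar>arctan t - t\<bar> \<le> \<bar>t\<bar> ^ 3"
proof -
  obtain z where z: "\<bar>z\<bar> \<le> \<bar>t\<bar>" "arctan t * (1 + z\<^sup>2) = t"
    by (rule arctan_mean_value)
  have "\<bar>arctan t\<bar> * 1 \<le> \<bar>arctan t\<bar> * (1 + z\<^sup>2)"
    by (intro mult_left_mono) auto
  also have "\<dots> = \<bar>t\<bar>"
    using arg_cong[OF z(2), of abs] by (simp add: abs_mult)
  finally have "\<bar>arctan t\<bar> * z\<^sup>2 \<le> \<bar>t\<bar> * t\<^sup>2"
    using z(1) by (intro mult_mono) (auto simp: abs_le_square_iff)
  moreover have "arctan t - t = - (arctan t * z\<^sup>2)"
    using z(2) by (simp add: algebra_simps)
  ultimately show ?thesis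
    by (simp add: abs_mult power2_eq_square power3_eq_cube)
qed

lemma abs_arctan_diff_le: "\<bar>arctan a - arctan b\<bar> \<le> \<bar>a - b\<bar>"
proof -
  have "norm (arctan a - arctan b) \<le> 1 * norm (a - b)"
  proof (rule field_differentiable_bound[of UNIV])
    show "(arctan has_field_derivative inverse (1 + z\<^sup>2)) (at z within UNIV)" for z
      by (rule DERIV_arctan)
    show "norm (inverse (1 + z\<^sup>2)) \<le> 1" for z :: real
      by (simp add: inverse_le_1_iff)
  qed auto
  then show ?thesis
    by simp
qed

section \<open>Criteria for the supremum norm, boundedness and the rate\<close>

lemma norm_axis: "norm (axis i a :: 'a::real_inner^'n) = norm a"
  by (simp add: norm_eq_sqrt_inner inner_axis_axis)

text \<open>A limit along a sequence serves both cases: a supremum only approached at infinity, and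
  an attained one, by a constant sequence. The first component alone suffices for the lower bound,
  since the norm is a maximum over components.\<close>

lemma Linf_norm_eqI:
  assumes "\<And>x j. \<bar>\<eta> x $ j\<bar> \<le> c" "(\<lambda>n. \<bar>\<eta> (f n) $ 1\<bar>) \<longlonglongrightarrow> c"
  shows "Linf_norm \<eta> = ereal c"
proof -
  have le: "(SUP x. ereal \<bar>\<eta> x $ j\<bar>) \<le> ereal c" for j
    using assms(1) by (intro SUP_least) auto
  have "(\<lambda>n. ereal \<bar>\<eta> (f n) $ 1\<bar>) \<longlonglongrightarrow> ereal c"
    using assms(2) by simp
  then have "ereal c \<le> (SUP x. ereal \<bar>\<eta> x $ 1\<bar>)"
    by (rule Lim_bounded) (auto intro: SUP_upper)
  with le[of 1] le[of 2] show ?thesis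
    by (simp add: Linf_norm_def)
qed

lemma bounded_range_cartI:
  fixes \<eta> :: "'a \<Rightarrow> real^'n"
  assumes "\<And>x j. \<bar>\<eta> x $ j\<bar> \<le> c"
  shows "bounded (range \<eta>)"
proof -
  have "norm (\<eta> x) \<le> (\<Sum>j\<in>(UNIV :: 'n set). c)" for x
    using norm_le_l1_cart[of "\<eta> x"] sum_mono[of UNIV "\<lambda>j. \<bar>\<eta> x $ j\<bar>" "\<lambda>_. c"] assms
    by (meson order_trans)
  then show ?thesis
    unfolding bounded_iff by auto
qed

text \<open>This passes from the explicit integer powers to real exponents, with the witnesses C =
  1, \<alpha> = m and \<beta> = n.\<close>

lemma powr_bound_of_power_bound:
  fixes \<eta> :: "real \<Rightarrow> 'a::real_normed_vector \<Rightarrow> 'a"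
  assumes "0 < m" "0 < n" and le: "\<And>\<epsilon> x. 0 < \<epsilon> \<Longrightarrow> norm (\<eta> \<epsilon> x - x) \<le> \<epsilon> ^ m * norm x ^ n"
  shows "\<exists>C>0. \<exists>\<alpha>>0. \<exists>\<beta>>0. \<forall>\<epsilon>>0. \<forall>x. norm (\<eta> \<epsilon> x - x) \<le> C * \<epsilon> powr \<alpha> * norm x powr \<beta>"
proof (intro exI conjI allI impI)
  show "norm (\<eta> \<epsilon> x - x) \<le> 1 * \<epsilon> powr real m * norm x powr real n" if "0 < \<epsilon>" for \<epsilon> x
    \<comment> \<open>At \<open>x = 0\<close> the powers \<open>powr\<close> and \<open>^\<close>
      are compared separately: both vanish, the latter because \<open>0 < n\<close>.\<close>
    using le[OF that, of x] that \<open>0 < n\<close>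
    by (cases "x = 0") (simp_all add: powr_realpow power_0_left)
qed (use assms in auto)

context
  fixes \<epsilon> :: real
  assumes \<epsilon>: "0 < \<epsilon>"
begin

section \<open>Lipschitz bounds\<close>

lemma lipschitz_eta1: "1-lipschitz_on UNIV (eta1 \<epsilon>)"
proof (rule lipschitz_onI)
  fix x y :: "real^2"
  let ?p = "1 + \<epsilon> * norm x" and ?q = "1 + \<epsilon> * norm y"
  have "1 * 1 \<le> ?p * ?q"
    using \<epsilon> by (intro mult_mono) auto
  then have "\<bar>norm x - norm y\<bar> * 1 \<le> \<bar>norm x - norm y\<bar> * (?p * ?q)"
    by (intro mult_left_mono) auto
  \<comment> \<open>The mixed terms \<epsilon> |x| |y| cancel, so only \<open>?p * ?q\<close> \<ge>
    1 is needed.\<close>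
  moreover have "norm x * ?q - norm y * ?p = norm x - norm y"
    by (simp add: algebra_simps)
  ultimately have "norm (eta1 \<epsilon> x - eta1 \<epsilon> y) \<le> norm (x - y)"
    unfolding eta1_def using \<epsilon> by (intro norm_diff_divideR_le) auto
  then show "dist (eta1 \<epsilon> x) (eta1 \<epsilon> y) \<le> 1 * dist x y"
    by (simp add: dist_norm)
qed simp

text \<open>With a = \<epsilon> |x| and b = \<epsilon> |y|, the radial numerator factors as (|x| -
  |y|) (1 - ab), and |1 - ab| \<le> 1 + ab \<le> (1 + a^2) (1 + b^2) because 2ab \<le> a^2 +
  b^2.\<close>

lemma lipschitz_eta2: "1-lipschitz_on UNIV (eta2 \<epsilon>)"
proof (rule lipschitz_onI)
  fix x y :: "real^2"
  let ?a = "\<epsilon> * norm x" and ?b = "\<epsilon> * norm y"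
  let ?p = "1 + \<epsilon>\<^sup>2 * (norm x)\<^sup>2" and ?q = "1 + \<epsilon>\<^sup>2 * (norm y)\<^sup>2"
  have "0 \<le> ?a * ?b" "0 \<le> ?a\<^sup>2 * ?b\<^sup>2" "2 * (?a * ?b) \<le> ?a\<^sup>2 + ?b\<^sup>2"
    using \<epsilon> sum_squares_bound[of ?a ?b] by auto
  then have "\<bar>1 - ?a * ?b\<bar> \<le> 1 + ?a\<^sup>2 + ?b\<^sup>2 + ?a\<^sup>2 * ?b\<^sup>2"
    by linarith
  also have "\<dots> = ?p * ?q"
    by (simp add: algebra_simps power_mult_distrib)
  finally have "\<bar>norm x - norm y\<bar> * \<bar>1 - ?a * ?b\<bar> \<le> \<bar>norm x - norm y\<bar> * (?p * ?q)"
    by (intro mult_left_mono) auto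
  moreover have "norm x * ?q - norm y * ?p = (norm x - norm y) * (1 - ?a * ?b)"
    by (simp add: algebra_simps power2_eq_square)
  ultimately have "norm (eta2 \<epsilon> x - eta2 \<epsilon> y) \<le> norm (x - y)"
    unfolding eta2_def by (intro norm_diff_divideR_le) (auto simp: abs_mult)
  then show "dist (eta2 \<epsilon> x) (eta2 \<epsilon> y) \<le> 1 * dist x y"
    by (simp add: dist_norm)
qed simp

lemma lipschitz_eta3: "1-lipschitz_on UNIV (eta3 \<epsilon>)"
proof (rule lipschitz_onI)
  fix x y :: "real^2"
  have "norm (eta3 \<epsilon> x - eta3 \<epsilon> y) \<le> norm (x - y)"
  proof (rule norm_le_componentwise_cart)
    fix j
    \<comment> \<open>The factor \<epsilon> gained here cancels the prefactor 1/\<epsilon> of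
      \<open>eta3\<close>.\<close>
    have "\<bar>arctan (\<epsilon> * x $ j) - arctan (\<epsilon> * y $ j)\<bar> \<le> \<epsilon> * \<bar>x $ j - y $ j\<bar>"
      using abs_arctan_diff_le[of "\<epsilon> * x $ j" "\<epsilon> * y $ j"] \<epsilon>
      by (simp add: abs_mult flip: right_diff_distrib)
    then show "norm ((eta3 \<epsilon> x - eta3 \<epsilon> y) $ j) \<le> norm ((x - y) $ j)"
      using \<epsilon> by (simp add: eta3_def divide_simps mult.commute flip: diff_divide_distrib)
  qed
  then show "dist (eta3 \<epsilon> x) (eta3 \<epsilon> y) \<le> 1 * dist x y"
    by (simp add: dist_norm)
qed simp

section \<open>Componentwise bounds and exact supremum norms\<close>

lemma eta1_component_le: "\<bar>eta1 \<epsilon> x $ j\<bar> \<le> 1 / \<epsilon>"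
proof -
  have pos: "0 < 1 + \<epsilon> * norm x"
    using \<epsilon> by (intro add_pos_nonneg) auto
  have "\<epsilon> * \<bar>x $ j\<bar> \<le> \<epsilon> * norm x"
    using \<epsilon> by (intro mult_left_mono component_le_norm_cart) auto
  then have "\<epsilon> * \<bar>x $ j\<bar> \<le> 1 + \<epsilon> * norm x"
    by linarith
  then show ?thesis
    using \<epsilon> pos by (simp add: eta1_def abs_mult field_simps)
qed

lemma eta2_component_le: "\<bar>eta2 \<epsilon> x $ j\<bar> \<le> 1 / (2 * \<epsilon>)"
proof -
  have pos: "0 < 1 + \<epsilon>\<^sup>2 * (norm x)\<^sup>2"
    by (intro add_pos_nonneg) auto
  have "\<epsilon> * \<bar>x $ j\<bar> \<le> \<epsilon> * norm x"
    using \<epsilon> by (intro mult_left_mono component_le_norm_cart) auto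
  \<comment> \<open>This is 2r \<le> 1 + r^2 at r = \<epsilon> |x|, with equality exactly at r =
    1.\<close>
  moreover have "2 * (\<epsilon> * norm x) \<le> 1 + \<epsilon>\<^sup>2 * (norm x)\<^sup>2"
    using sum_squares_bound[of 1 "\<epsilon> * norm x"] by (simp add: power_mult_distrib)
  ultimately have "2 * (\<epsilon> * \<bar>x $ j\<bar>) \<le> 1 + \<epsilon>\<^sup>2 * (norm x)\<^sup>2"
    by linarith
  then show ?thesis
    using \<epsilon> pos by (simp add: eta2_def abs_mult field_simps)
qed

lemma eta3_component_le: "\<bar>eta3 \<epsilon> x $ j\<bar> \<le> pi / (2 * \<epsilon>)"
proof -
  have "\<bar>arctan (\<epsilon> * x $ j)\<bar> \<le> pi / 2"
    using arctan_bounded[of "\<epsilon> * x $ j"] by linarith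
  then show ?thesis
    using \<epsilon> by (simp add: eta3_def abs_mult field_simps)
qed

lemma Linf_norm_eta1: "Linf_norm (eta1 \<epsilon>) = ereal (1 / \<epsilon>)"
proof (rule Linf_norm_eqI[OF eta1_component_le, where f = "\<lambda>n. axis 1 (real (Suc n))"])
  \<comment> \<open>The profile r / (1 + \<epsilon> r) is rewritten as 1 / (1/r + \<epsilon>), which
    needs r nonzero; hence \<open>Suc n\<close>.\<close>
  have "(\<lambda>n. inverse (inverse (real (Suc n)) + \<epsilon>)) \<longlonglongrightarrow> inverse (0 + \<epsilon>)"
    using \<epsilon> by (intro tendsto_inverse tendsto_add LIMSEQ_inverse_real_of_nat tendsto_const) simp
  also have "(\<lambda>n. inverse (inverse (real (Suc n)) + \<epsilon>)) = (\<lambda>n. real (Suc n) / (1 + \<epsilon> * real (Suc n)))"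
    using \<epsilon> by (simp add: divide_simps fun_eq_iff add_pos_pos mult.commute del: of_nat_Suc)
  finally show "(\<lambda>n. \<bar>eta1 \<epsilon> (axis 1 (real (Suc n))) $ 1\<bar>) \<longlonglongrightarrow> 1 / \<epsilon>"
    using \<epsilon> by (simp add: eta1_def abs_mult norm_axis divide_inverse mult.commute del: of_nat_Suc)
qed

lemma Linf_norm_eta2: "Linf_norm (eta2 \<epsilon>) = ereal (1 / (2 * \<epsilon>))"
\<comment> \<open>The supremum is attained where \<epsilon> |x| = 1, the equality case of the bound,
  so a constant sequence is enough.\<close>
proof (rule Linf_norm_eqI[OF eta2_component_le, where f = "\<lambda>n. axis 1 (1 / \<epsilon>)"])
  show "(\<lambda>n. \<bar>eta2 \<epsilon> (axis 1 (1 / \<epsilon>)) $ 1\<bar>) \<longlonglongrightarrow> 1 / (2 * \<epsilon>)"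
    using \<epsilon> by (simp add: eta2_def power_divide norm_axis)
qed

lemma Linf_norm_eta3: "Linf_norm (eta3 \<epsilon>) = ereal (pi / (2 * \<epsilon>))"
proof (rule Linf_norm_eqI[OF eta3_component_le, where f = "\<lambda>n. axis 1 (real n)"])
  have "filterlim (\<lambda>n. \<epsilon> * real n) at_top sequentially"
    by (rule filterlim_tendsto_pos_mult_at_top[OF tendsto_const \<epsilon> filterlim_real_sequentially])
  then have "(\<lambda>n. arctan (\<epsilon> * real n) / \<epsilon>) \<longlonglongrightarrow> pi / 2 / \<epsilon>"
    using \<epsilon> by (intro tendsto_divide tendsto_const filterlim_compose[OF tendsto_arctan_at_top]) auto
  then show "(\<lambda>n. \<bar>eta3 \<epsilon> (axis 1 (real n)) $ 1\<bar>) \<longlonglongrightarrow> pi / (2 * \<epsilon>)"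
    using \<epsilon> by (simp add: eta3_def abs_mult)
qed

section \<open>Rates of convergence to the identity\<close>

lemma norm_eta1_diff_le: "norm (eta1 \<epsilon> x - x) \<le> \<epsilon> * norm x ^ 2"
  using norm_divideR_one_plus_diff_le[of "\<epsilon> * norm x" x] \<epsilon>
  by (simp add: eta1_def power2_eq_square mult.assoc)

lemma norm_eta2_diff_le: "norm (eta2 \<epsilon> x - x) \<le> \<epsilon> ^ 2 * norm x ^ 3"
  using norm_divideR_one_plus_diff_le[of "\<epsilon>\<^sup>2 * (norm x)\<^sup>2" x]
  by (simp add: eta2_def power2_eq_square[of "norm x"] power3_eq_cube mult.assoc)

lemma norm_eta3_diff_le: "norm (eta3 \<epsilon> x - x) \<le> \<epsilon> ^ 2 * norm x ^ 3"
proof -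
  \<comment> \<open>Only two of the three factors |x_j| are enlarged to |x|. The comparison vector
    is then a multiple of \<open>x\<close> with norm exactly \<epsilon>^2 |x|^3, whereas bounding
    every component by \<epsilon>^2 |x|^3 would cost a dimensional constant.\<close>
  have "norm (eta3 \<epsilon> x - x) \<le> norm ((\<epsilon>\<^sup>2 * (norm x)\<^sup>2) *\<^sub>R x)"
  proof (rule norm_le_componentwise_cart)
    fix j
    have "\<bar>arctan (\<epsilon> * x $ j) - \<epsilon> * x $ j\<bar> \<le> (\<epsilon> * \<bar>x $ j\<bar>) ^ 3"
      using abs_arctan_diff_self_le[of "\<epsilon> * x $ j"] \<epsilon> by (simp add: abs_mult)
    also have "\<dots> = \<epsilon> * (\<epsilon>\<^sup>2 * \<bar>x $ j\<bar>\<^sup>2 * \<bar>x $ j\<bar>)"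
      by (simp add: power2_eq_square power3_eq_cube mult_ac)
    also have "\<dots> \<le> \<epsilon> * (\<epsilon>\<^sup>2 * (norm x)\<^sup>2 * \<bar>x $ j\<bar>)"
      using \<epsilon> by (intro mult_left_mono mult_right_mono power_mono component_le_norm_cart) auto
    finally have *: "\<bar>arctan (\<epsilon> * x $ j) - \<epsilon> * x $ j\<bar> / \<epsilon> \<le> \<epsilon>\<^sup>2 * (norm x)\<^sup>2 * \<bar>x $ j\<bar>"
      using \<epsilon> by (simp add: divide_le_eq mult.commute)
    have "(eta3 \<epsilon> x - x) $ j = (arctan (\<epsilon> * x $ j) - \<epsilon> * x $ j) / \<epsilon>"
      using \<epsilon> by (simp add: eta3_def field_simps)
    with * show "norm ((eta3 \<epsilon> x - x) $ j) \<le> norm (((\<epsilon>\<^sup>2 * (norm x)\<^sup>2) *\<^sub>R x) $ j)"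
      using \<epsilon> by (simp add: abs_mult)
  qed
  then show ?thesis
    by (simp add: abs_mult power2_eq_square[of "norm x"] power3_eq_cube mult.assoc)
qed

end

section \<open>Assembly of the three families\<close>

theorem proposition1p4:
  shows "(\<forall>\<eta>\<in>{eta1, eta2, eta3}.
            (\<forall>\<epsilon>>0. 1-lipschitz_on UNIV (\<eta> \<epsilon>)) \<and>
            (\<forall>\<epsilon>>0. bounded (range (\<eta> \<epsilon>))) \<and>
            (\<exists>C>0. \<exists>\<alpha>>0. \<exists>\<beta>>0. \<forall>\<epsilon>>0. \<forall>x.
                norm (\<eta> \<epsilon> x - x) \<le> C * \<epsilon> powr \<alpha> * norm x powr \<beta>)) \<and>
         (\<forall>\<epsilon>>0.
            Linf_norm (eta1 \<epsilon>) = ereal (1 / \<epsilon>) \<and>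
            (\<forall>x. norm (eta1 \<epsilon> x - x) \<le> \<epsilon> * norm x ^ 2) \<and>
            Linf_norm (eta2 \<epsilon>) = ereal (1 / (2 * \<epsilon>)) \<and>
            (\<forall>x. norm (eta2 \<epsilon> x - x) \<le> \<epsilon> ^ 2 * norm x ^ 3) \<and>
            Linf_norm (eta3 \<epsilon>) = ereal (pi / (2 * \<epsilon>)) \<and>
            (\<forall>x. norm (eta3 \<epsilon> x - x) \<le> \<epsilon> ^ 2 * norm x ^ 3))"
proof -
  have "\<exists>C>0. \<exists>\<alpha>>0. \<exists>\<beta>>0. \<forall>\<epsilon>>0. \<forall>x. norm (eta1 \<epsilon> x - x) \<le> C * \<epsilon> powr \<alpha> * norm x powr \<beta>"
    by (rule powr_bound_of_power_bound[of 1 2]) (simp_all add: norm_eta1_diff_le)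
  moreover have "\<exists>C>0. \<exists>\<alpha>>0. \<exists>\<beta>>0. \<forall>\<epsilon>>0. \<forall>x. norm (eta2 \<epsilon> x - x) \<le> C * \<epsilon> powr \<alpha> * norm x powr \<beta>"
    by (rule powr_bound_of_power_bound[of 2 3]) (simp_all add: norm_eta2_diff_le)
  moreover have "\<exists>C>0. \<exists>\<alpha>>0. \<exists>\<beta>>0. \<forall>\<epsilon>>0. \<forall>x. norm (eta3 \<epsilon> x - x) \<le> C * \<epsilon> powr \<alpha> * norm x powr \<beta>"
    by (rule powr_bound_of_power_bound[of 2 3]) (simp_all add: norm_eta3_diff_le)
  ultimately have rate: "\<exists>C>0. \<exists>\<alpha>>0. \<exists>\<beta>>0. \<forall>\<epsilon>>0. \<forall>x.
      norm (\<eta> \<epsilon> x - x) \<le> C * \<epsilon> powr \<alpha> * norm x powr \<beta>" if "\<eta> \<in> {eta1, eta2, eta3}" for \<eta>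
    using that by (elim insertE emptyE) (simp only:)+
  have lip: "1-lipschitz_on UNIV (\<eta> \<epsilon>)" if "\<eta> \<in> {eta1, eta2, eta3}" "0 < \<epsilon>" for \<eta> \<epsilon>
    using that lipschitz_eta1 lipschitz_eta2 lipschitz_eta3 by blast
  \<comment> \<open>Boundedness comes directly from the componentwise bounds behind the supremum
    norms.\<close>
  have bdd: "bounded (range (\<eta> \<epsilon>))" if "\<eta> \<in> {eta1, eta2, eta3}" "0 < \<epsilon>" for \<eta> \<epsilon>
    using that bounded_range_cartI[of "eta1 \<epsilon>", OF eta1_component_le]
      bounded_range_cartI[of "eta2 \<epsilon>", OF eta2_component_le]
      bounded_range_cartI[of "eta3 \<epsilon>", OF eta3_component_le] by auto
  show ?thesis
    by (intro conjI ballI allI impI rate lip bdd Linf_norm_eta1 Linf_norm_eta2 Linf_norm_eta3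
        norm_eta1_diff_le norm_eta2_diff_le norm_eta3_diff_le; assumption)
qed

end
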